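(* Let $d$ be a bounded pseudo-metric on a nonempty set $X$ and let $f,g\subset X\times X$ be relations on $X$. Then $$m_d^{\mathcal C_df}=m_d^f\quad\text{and}\quad \ell_d^{\mathcal A_df}=\ell_d^f .$$ The operators $\mathcal C_d$ and $\mathcal A_d$ on relations are idempotent, that is, $$\mathcal C_d(\mathcal C_df)=\mathcal C_df\quad\text{and}\quad\mathcal A_d(\mathcal A_df)=\mathcal A_df .$$ In addition, $$\mathcal C_d(\mathcal C_df\cap\mathcal C_dg)=\mathcal C_df\cap\mathcal C_dg\quad\text{and}\quad \mathcal A_d(\mathcal A_df\cap\mathcal A_dg)=\mathcal A_df\cap\mathcal A_dg .$$
   Context: A relation on $X$ is a subset of $X\times X$. For a relation $f$ and $x,y\in X$ the barrier functions are $$\ell_d^f(x,y)=\inf\Big\{d(x,a_1)+\sum_{i=1}^{n-1}d(b_i,a_{i+1})+d(b_n,y)\Big\},\qquad m_d^f(x,y)=\inf\big\{\max(d(x,a_1),d(b_1,a_2),\dots,d(b_{n-1},a_n),d(b_n,y))\big\},$$ both infima over all $n\ge1$ and all finite sequences $(a_1,b_1),\dots,(a_n,b_n)$ of elements of $f$. By convention, for $f=\emptyset$, $m_d^{\emptyset}$ is the constant $\mathrm{diam}(X)=\sup d$ and $\ell_d^{\emptyset}$ is the constant $2\,\mathrm{diam}(X)$. Define $\mathcal C_df=\{(x,y):m_d^f(x,y)=0\}$ and $\mathcal A_df=\{(x,y):\ell_d^f(x,y)=0\}$. *)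

theory Defs
  imports "HOL-Analysis.Analysis"
begin

locale pseudo_metric_on =
  fixes X :: "'a set" and d :: "'a \<Rightarrow> 'a \<Rightarrow> real"
  assumes nonneg: "\<And>x y. x \<in> X \<Longrightarrow> y \<in> X \<Longrightarrow> 0 \<le> d x y"
    and self_zero: "\<And>x. x \<in> X \<Longrightarrow> d x x = 0"
    and commute: "\<And>x y. x \<in> X \<Longrightarrow> y \<in> X \<Longrightarrow> d x y = d y x"
    and triangle: "\<And>x y z. x \<in> X \<Longrightarrow> y \<in> X \<Longrightarrow> z \<in> X \<Longrightarrow> d x z \<le> d x y + d y z"

locale bounded_pseudo_metric_on = pseudo_metric_on +
  assumes bounded: "\<exists>B. \<forall>x\<in>X. \<forall>y\<in>X. d x y \<le> B"

(* Real suprema and infima are unspecified for unbounded or empty sets. The definitions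
   below are meant for a bounded pseudo-metric d on a nonempty carrier X, for points x, y
   of X and for a relation f included in X \<times> X, where they are well-behaved. *)

definition diam :: "'a set \<Rightarrow> ('a \<Rightarrow> 'a \<Rightarrow> real) \<Rightarrow> real" where
  "diam X d = (SUP (x, y)\<in>X \<times> X. d x y)"

(* The pairs (a 1, b 1), ..., (a n, b n) are the chain; values of a and b outside {1..n}
   are irrelevant. *)

definition chain_in :: "('a \<times> 'a) set \<Rightarrow> nat \<Rightarrow> (nat \<Rightarrow> 'a) \<Rightarrow> (nat \<Rightarrow> 'a) \<Rightarrow> bool" where
  "chain_in f n a b \<longleftrightarrow> 1 \<le> n \<and> (\<forall>i\<in>{1..n}. (a i, b i) \<in> f)"

definition chain_length ::
  "('a \<Rightarrow> 'a \<Rightarrow> real) \<Rightarrow> 'a \<Rightarrow> 'a \<Rightarrow> nat \<Rightarrow> (nat \<Rightarrow> 'a) \<Rightarrow> (nat \<Rightarrow> 'a) \<Rightarrow> real" where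
  "chain_length d x y n a b = d x (a 1) + (\<Sum>i=1..n-1. d (b i) (a (i + 1))) + d (b n) y"

definition chain_bound ::
  "('a \<Rightarrow> 'a \<Rightarrow> real) \<Rightarrow> 'a \<Rightarrow> 'a \<Rightarrow> nat \<Rightarrow> (nat \<Rightarrow> 'a) \<Rightarrow> (nat \<Rightarrow> 'a) \<Rightarrow> real" where
  "chain_bound d x y n a b =
     Max ({d x (a 1)} \<union> (\<lambda>i. d (b i) (a (i + 1))) ` {1..n-1} \<union> {d (b n) y})"

definition barrier_l ::
  "'a set \<Rightarrow> ('a \<Rightarrow> 'a \<Rightarrow> real) \<Rightarrow> ('a \<times> 'a) set \<Rightarrow> 'a \<Rightarrow> 'a \<Rightarrow> real" where
  "barrier_l X d f x y =
     (if f = {} then 2 * diam X d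
      else Inf {chain_length d x y n a b | n a b. chain_in f n a b})"

definition barrier_m ::
  "'a set \<Rightarrow> ('a \<Rightarrow> 'a \<Rightarrow> real) \<Rightarrow> ('a \<times> 'a) set \<Rightarrow> 'a \<Rightarrow> 'a \<Rightarrow> real" where
  "barrier_m X d f x y =
     (if f = {} then diam X d
      else Inf {chain_bound d x y n a b | n a b. chain_in f n a b})"

definition C_rel ::
  "'a set \<Rightarrow> ('a \<Rightarrow> 'a \<Rightarrow> real) \<Rightarrow> ('a \<times> 'a) set \<Rightarrow> ('a \<times> 'a) set" where
  "C_rel X d f = {(x, y) \<in> X \<times> X. barrier_m X d f x y = 0}"

definition A_rel ::
  "'a set \<Rightarrow> ('a \<Rightarrow> 'a \<Rightarrow> real) \<Rightarrow> ('a \<times> 'a) set \<Rightarrow> ('a \<times> 'a) set" where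
  "A_rel X d f = {(x, y) \<in> X \<times> X. barrier_l X d f x y = 0}"

end

(* Both barriers are instances of one construction, in which the distances along a chain are
   combined by an operation opr that is either + or max; the convention for the empty relation
   is then opr D D with D the diameter. The only properties of opr needed are that it is monotone
   with neutral element 0 and satisfies opr (r + u) (w + v) <= opr r w + opr u v. This inequality
   gives the main step: in a chain, a link (a, b) can be replaced by a chain from a to b of small
   cost s, and the total cost increases by at most s. Replacing all links of a chain in the closure
   of f yields a chain in f whose cost is larger by an arbitrarily small amount. *)
theory Submission
  imports Defs
begin

lemma (in bounded_pseudo_metric_on) dist_le_diam:
  assumes "x \<in> X" "y \<in> X"
  shows "d x y \<le> diam X d"
proof -
  obtain B where B: "\<forall>x\<in>X. \<forall>y\<in>X. d x y \<le> B" using bounded by blast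
  have "bdd_above ((\<lambda>(x, y). d x y) ` (X \<times> X))"
    using B by (auto intro!: bdd_aboveI[of _ B])
  from cSUP_upper[OF _ this, of "(x, y)"] assms show ?thesis
    by (simp add: diam_def)
qed

section \<open>Chains and their costs for a general operation\<close>

inductive chain_cost ::
  "(real \<Rightarrow> real \<Rightarrow> real) \<Rightarrow> ('a \<Rightarrow> 'a \<Rightarrow> real) \<Rightarrow> ('a \<times> 'a) set \<Rightarrow> 'a \<Rightarrow> nat \<Rightarrow> 'a \<Rightarrow> real \<Rightarrow> bool"
  for opr d f x where
  base: "chain_cost opr d f x 0 y (d x y)"
| step: "chain_cost opr d f x n a r \<Longrightarrow> (a, b) \<in> f \<Longrightarrow> chain_cost opr d f x (Suc n) y (opr r (d b y))"

inductive_cases chain_cost_0E: "chain_cost opr d f x 0 y r"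
inductive_cases chain_cost_SucE: "chain_cost opr d f x (Suc n) y r"

lemma chain_cost_mono:
  assumes "chain_cost opr d f x n y r" "f \<subseteq> g"
  shows "chain_cost opr d g x n y r"
  using assms by induction (auto intro: chain_cost.intros)

text \<open>\<open>Suc n\<close> excludes the link-free chain, which would force the infimum below
  \<open>d x y\<close>.\<close>

definition barrier ::
  "'a set \<Rightarrow> ('a \<Rightarrow> 'a \<Rightarrow> real) \<Rightarrow> (real \<Rightarrow> real \<Rightarrow> real) \<Rightarrow> ('a \<times> 'a) set \<Rightarrow> 'a \<Rightarrow> 'a \<Rightarrow> real" where
  "barrier X d opr f x y =
     (if f = {} then opr (diam X d) (diam X d)
      else Inf {r. \<exists>n. chain_cost opr d f x (Suc n) y r})"

definition barrier_rel ::
  "'a set \<Rightarrow> ('a \<Rightarrow> 'a \<Rightarrow> real) \<Rightarrow> (real \<Rightarrow> real \<Rightarrow> real) \<Rightarrow> ('a \<times> 'a) set \<Rightarrow> ('a \<times> 'a) set" where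
  "barrier_rel X d opr f = {(x, y) \<in> X \<times> X. barrier X d opr f x y = 0}"

text \<open>For addition the interchange law is an equality; for \<open>max\<close> it says that a
  maximum of sums is at most the sum of the maxima.\<close>

locale barrier_operation = bounded_pseudo_metric_on X d
  for X :: "'a set" and d :: "'a \<Rightarrow> 'a \<Rightarrow> real" +
  fixes opr :: "real \<Rightarrow> real \<Rightarrow> real"
  assumes opr_mono: "\<And>r r' s s'. r \<le> r' \<Longrightarrow> s \<le> s' \<Longrightarrow> opr r s \<le> opr r' s'"
    and opr_0_right: "\<And>r. 0 \<le> r \<Longrightarrow> opr r 0 = r"
    and opr_0_left: "\<And>r. 0 \<le> r \<Longrightarrow> opr 0 r = r"
    and opr_interchange: "\<And>r u w v. 0 \<le> r \<Longrightarrow> 0 \<le> u \<Longrightarrow> 0 \<le> w \<Longrightarrow> 0 \<le> v \<Longrightarrow>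
      opr (r + u) (w + v) \<le> opr r w + opr u v"
begin

abbreviation "cost \<equiv> chain_cost opr d"
abbreviation "bar \<equiv> barrier X d opr"
abbreviation "rel \<equiv> barrier_rel X d opr"

lemma le_opr_left: "0 \<le> r \<Longrightarrow> 0 \<le> s \<Longrightarrow> r \<le> opr r s"
  using opr_mono[of r r 0 s] opr_0_right[of r] by simp

lemma opr_nonneg: "0 \<le> r \<Longrightarrow> 0 \<le> s \<Longrightarrow> 0 \<le> opr r s"
  using le_opr_left[of r s] by simp

lemma cost_nonneg:
  assumes "cost f x n y r" "f \<subseteq> X \<times> X" "x \<in> X" "y \<in> X"
  shows "0 \<le> r"
  using assms
proof induction
  case (step n a r b y)
  then have "a \<in> X" "b \<in> X" by auto
  with step show ?case by (intro opr_nonneg nonneg) auto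
qed (simp add: nonneg)

text \<open>Only the final distance involves the endpoint. The triangle inequality adds
  \<open>d y z\<close> to it, and the interchange law moves this term outside
  \<open>opr\<close>.\<close>

lemma cost_change_endpoint:
  assumes "cost f x n y r" "f \<subseteq> X \<times> X" "x \<in> X" "y \<in> X" "z \<in> X"
  shows "\<exists>t. cost f x n z t \<and> t \<le> r + d y z"
  using assms(1)
proof cases
  case base
  then show ?thesis
    using assms triangle[of x y z] by (auto intro: chain_cost.base)
next
  case (step m a s b)
  have in_X: "a \<in> X" "b \<in> X" using step assms by auto
  have s0: "0 \<le> s" using cost_nonneg step in_X assms by blast
  have "opr s (d b z) \<le> opr (s + 0) (d b y + d y z)"
    using assms in_X triangle[of b y z] by (intro opr_mono) auto
  also have "\<dots> \<le> opr s (d b y) + opr 0 (d y z)"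
    using assms in_X s0 nonneg by (intro opr_interchange) auto
  also have "opr 0 (d y z) = d y z"
    using assms nonneg by (intro opr_0_left) auto
  finally show ?thesis
    using step by (auto intro: chain_cost.step)
qed

text \<open>The bound compares with the chain that jumps from \<open>a\<close> to \<open>b\<close>
  as if \<open>(a, b)\<close> were a link. With \<open>n = 0\<close> it can fail for
  \<open>max\<close>: without a link in between, the triangle inequality adds \<open>r\<close> and
  \<open>d b y\<close> instead of taking their maximum.\<close>

lemma cost_splice:
  assumes "cost f a n b s" "0 < n" "cost f x m a r"
    and "f \<subseteq> X \<times> X" "x \<in> X" "a \<in> X" "b \<in> X" "y \<in> X"
  shows "\<exists>k t. cost f x (Suc k) y t \<and> t \<le> opr r (d b y) + s"
  using assms
proof (induction arbitrary: y)
  case (base b)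
  then show ?case by simp
next
  case (step n p s q b)
  have in_X: "p \<in> X" "q \<in> X" using step by auto
  have r0: "0 \<le> r" and s0: "0 \<le> s" using cost_nonneg step in_X by blast+
  \<comment> \<open>The chain is first brought to the source \<open>p\<close> of the last link
    \<open>(p, q)\<close>.\<close>
  have "\<exists>k t. cost f x k p t \<and> t \<le> r + s"
  proof (cases "n = 0")
    case True
    with step have "s = d a p" by (auto elim: chain_cost_0E)
    with cost_change_endpoint[OF step.prems(2)] step in_X show ?thesis by blast
  next
    case False
    \<comment> \<open>Taking \<open>p\<close> as the endpoint makes the final distance
      \<open>d p p = 0\<close>.\<close>
    with step.IH[of p] step.prems in_X
    obtain k t where "cost f x (Suc k) p t" "t \<le> opr r (d p p) + s" by auto
    moreover have "opr r (d p p) = r"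
      using self_zero in_X r0 by (simp add: opr_0_right)
    ultimately show ?thesis by auto
  qed
  then obtain k t where t: "cost f x k p t" "t \<le> r + s" by blast
  \<comment> \<open>After the interchange, \<open>s\<close> meets \<open>d q b\<close>, which
    restores the cost of the whole inserted chain.\<close>
  have "opr t (d q y) \<le> opr (r + s) (d b y + d q b)"
    using t step in_X triangle[of q b y] by (intro opr_mono) auto
  also have "\<dots> \<le> opr r (d b y) + opr s (d q b)"
    using r0 s0 step in_X nonneg by (intro opr_interchange) auto
  finally show ?case
    using t step by (auto intro: chain_cost.step)
qed

section \<open>The barrier as an infimum, and its monotonicity\<close>

lemma bdd_below_costs:
  assumes "f \<subseteq> X \<times> X" "x \<in> X" "y \<in> X"
  shows "bdd_below {r. \<exists>n. cost f x (Suc n) y r}"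
  by (rule bdd_belowI[of _ 0]) (use cost_nonneg assms in blast)

lemma cost_single: "(a, b) \<in> f \<Longrightarrow> cost f x (Suc 0) y (opr (d x a) (d b y))"
  by (auto intro: chain_cost.intros)

lemma costs_nonempty: "f \<noteq> {} \<Longrightarrow> {r. \<exists>n. cost f x (Suc n) y r} \<noteq> {}"
  using cost_single by fastforce

lemma bar_le_cost:
  assumes "cost f x (Suc n) y r" "f \<subseteq> X \<times> X" "x \<in> X" "y \<in> X"
  shows "bar f x y \<le> r"
proof -
  have "f \<noteq> {}" using assms(1) by (auto elim: chain_cost_SucE)
  then show ?thesis
    using assms bdd_below_costs by (auto simp: barrier_def intro!: cInf_lower)
qed

lemma le_bar:
  assumes "f \<noteq> {}" "\<And>n r. cost f x (Suc n) y r \<Longrightarrow> c \<le> r"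
  shows "c \<le> bar f x y"
proof -
  have "c \<le> Inf {r. \<exists>n. cost f x (Suc n) y r}"
    by (rule cInf_greatest[OF costs_nonempty[OF assms(1)]]) (use assms(2) in auto)
  with assms(1) show ?thesis by (simp add: barrier_def)
qed

lemma diam_nonneg: "x \<in> X \<Longrightarrow> 0 \<le> diam X d"
  using dist_le_diam[of x x] self_zero by simp

lemma bar_nonneg:
  assumes "f \<subseteq> X \<times> X" "x \<in> X" "y \<in> X"
  shows "0 \<le> bar f x y"
proof (cases "f = {}")
  case True
  then show ?thesis using diam_nonneg assms by (simp add: barrier_def opr_nonneg)
next
  case False
  then show ?thesis using cost_nonneg assms by (blast intro: le_bar)
qed

lemma bar_antimono:
  assumes "f \<subseteq> g" "g \<subseteq> X \<times> X" "x \<in> X" "y \<in> X"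
  shows "bar g x y \<le> bar f x y"
proof (cases "f = {}")
  case False
  show ?thesis
  proof (rule le_bar[OF False])
    fix n r assume "cost f x (Suc n) y r"
    with assms show "bar g x y \<le> r" by (blast intro: bar_le_cost chain_cost_mono)
  qed
next
  case f_empty: True
  show ?thesis
  proof (cases "g = {}")
    case False
    then obtain a b where ab: "(a, b) \<in> g" by auto
    then have in_X: "a \<in> X" "b \<in> X" using assms by auto
    \<comment> \<open>The value chosen for the empty relation dominates the cost of every one-link
      chain.\<close>
    have "bar g x y \<le> opr (d x a) (d b y)"
      using bar_le_cost[OF cost_single[OF ab]] assms by blast
    also have "\<dots> \<le> opr (diam X d) (diam X d)"
      using in_X assms by (intro opr_mono dist_le_diam)
    finally show ?thesis using f_empty by (simp add: barrier_def)
  qed (use f_empty in simp)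
qed

lemma rel_subset: "rel f \<subseteq> X \<times> X"
  by (auto simp: barrier_rel_def)

text \<open>The pair \<open>(x, y)\<close> is itself a one-link chain from \<open>x\<close> to
  \<open>y\<close>, of cost \<open>opr 0 0 = 0\<close>.\<close>

lemma subset_rel:
  assumes "f \<subseteq> X \<times> X"
  shows "f \<subseteq> rel f"
proof (rule subrelI)
  fix x y assume xy: "(x, y) \<in> f"
  then have in_X: "x \<in> X" "y \<in> X" using assms by auto
  have "bar f x y \<le> opr (d x x) (d y y)"
    using bar_le_cost[OF cost_single[OF xy]] in_X assms by blast
  also have "\<dots> = 0" using in_X self_zero opr_0_right by simp
  finally show "(x, y) \<in> rel f"
    using bar_nonneg[OF assms] in_X by (force simp: barrier_rel_def)
qed

lemma rel_mono:
  assumes "f \<subseteq> g" "g \<subseteq> X \<times> X"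
  shows "rel f \<subseteq> rel g"
proof (rule subrelI)
  fix x y assume "(x, y) \<in> rel f"
  then show "(x, y) \<in> rel g"
    using bar_antimono[OF assms, of x y] bar_nonneg[OF assms(2), of x y]
    by (auto simp: barrier_rel_def)
qed

section \<open>Invariance of the barrier under closure\<close>

text \<open>Since \<open>e\<close> is arbitrary in the induction, half of it pays for the earlier
  links and half for the last one. The final conjunct ensures that the new chain counts in the
  infimum defining \<open>bar f\<close>.\<close>

lemma cost_rel_approx:
  assumes "cost (rel f) x n y r" "f \<subseteq> X \<times> X" "f \<noteq> {}" "x \<in> X" "y \<in> X" "0 < e"
  shows "\<exists>k t. cost f x k y t \<and> t \<le> r + e \<and> (0 < n \<longrightarrow> 0 < k)"
  using assms
proof (induction arbitrary: e)
  case (base y)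
  then show ?case
    by (intro exI[of _ 0] exI[of _ "d x y"]) (auto intro: chain_cost.base)
next
  case (step n a r b y)
  have in_X: "a \<in> X" "b \<in> X" using step rel_subset by blast+
  have r0: "0 \<le> r" using cost_nonneg[OF step.hyps(1) rel_subset] step in_X by blast
  obtain k t where t: "cost f x k a t" "t \<le> r + e / 2"
    using step.IH[of "e / 2"] step.prems in_X by auto
  \<comment> \<open>As \<open>f\<close> is nonempty, \<open>(a, b) \<in> rel f\<close> says that
    this infimum is 0.\<close>
  have "Inf {r. \<exists>n. cost f a (Suc n) b r} < e / 2"
    using step by (auto simp: barrier_rel_def barrier_def)
  then obtain s m where s: "cost f a (Suc m) b s" "s < e / 2"
    using cInf_lessD[OF costs_nonempty[OF step.prems(2)]] by blast
  obtain k' t' where t': "cost f x (Suc k') y t'" "t' \<le> opr t (d b y) + s"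
    using cost_splice[OF s(1) _ t(1)] step.prems in_X by blast
  have "opr t (d b y) \<le> opr (r + e / 2) (d b y + 0)"
    using t by (intro opr_mono) auto
  also have "\<dots> \<le> opr r (d b y) + opr (e / 2) 0"
    using r0 step.prems in_X nonneg by (intro opr_interchange) auto
  also have "opr (e / 2) 0 = e / 2" using step.prems by (simp add: opr_0_right)
  finally have "t' \<le> opr r (d b y) + e" using t' s by simp
  with t' show ?case by blast
qed

lemma bar_rel:
  assumes "f \<subseteq> X \<times> X" "x \<in> X" "y \<in> X"
  shows "bar (rel f) x y = bar f x y"
proof (rule antisym)
  show "bar (rel f) x y \<le> bar f x y"
    using bar_antimono[OF subset_rel rel_subset] assms by blast
  show "bar f x y \<le> bar (rel f) x y"
  proof (cases "f = {}")
    case True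
    show ?thesis
    proof (cases "rel f = {}")
      case False
      \<comment> \<open>A pair in \<open>rel {}\<close> exists only if the conventional value is 0,
        and then nonnegativity suffices.\<close>
      with True have "opr (diam X d) (diam X d) = 0"
        by (auto simp: barrier_rel_def barrier_def)
      with True show ?thesis
        using bar_nonneg[OF rel_subset] assms by (simp add: barrier_def)
    qed (use True in simp)
  next
    case False
    then have "rel f \<noteq> {}" using subset_rel assms by blast
    then show ?thesis
    proof (rule le_bar)
      fix n r assume cost_r: "cost (rel f) x (Suc n) y r"
      show "bar f x y \<le> r"
      proof (rule field_le_epsilon)
        fix e :: real assume "0 < e"
        with cost_rel_approx[OF cost_r assms(1) False assms(2,3)]
        obtain k t where t: "cost f x k y t" "t \<le> r + e" "0 < k" by blast
        then obtain k' where "k = Suc k'" using gr0_conv_Suc by blast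
        with t bar_le_cost assms show "bar f x y \<le> r + e" by fastforce
      qed
    qed
  qed
qed

lemma rel_rel:
  assumes "f \<subseteq> X \<times> X"
  shows "rel (rel f) = rel f"
  using bar_rel[OF assms] by (auto simp: barrier_rel_def[of X d opr])

text \<open>For any monotone, extensive and idempotent operator, intersections of closed sets are
  closed.\<close>

lemma rel_inter_rel:
  assumes "f \<subseteq> X \<times> X" "g \<subseteq> X \<times> X"
  shows "rel (rel f \<inter> rel g) = rel f \<inter> rel g"
proof
  have "rel (rel f \<inter> rel g) \<subseteq> rel (rel f)" "rel (rel f \<inter> rel g) \<subseteq> rel (rel g)"
    by (intro rel_mono rel_subset; simp)+
  with rel_rel assms show "rel (rel f \<inter> rel g) \<subseteq> rel f \<inter> rel g" by simp
  show "rel f \<inter> rel g \<subseteq> rel (rel f \<inter> rel g)"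
    using rel_subset by (intro subset_rel) blast
qed

end

section \<open>Agreement with the barriers defined by sequences\<close>

text \<open>With n = 0 the functions \<^term>\<open>chain_length\<close> and \<^term>\<open>chain_bound\<close> do not
  describe the empty chain, so the recursions start at n = 1.\<close>

lemma chain_length_1: "chain_length d x y (Suc 0) a b = d x (a 1) + d (b 1) y"
  by (simp add: chain_length_def)

text \<open>When the last link is cut off, the gap before it becomes the final distance of the
  shorter chain, as in \<open>chain_cost.step\<close>.\<close>

lemma chain_length_Suc:
  "chain_length d x y (Suc (Suc n)) a b =
     chain_length d x (a (Suc (Suc n))) (Suc n) a b + d (b (Suc (Suc n))) y"
  by (simp add: chain_length_def)

lemma chain_bound_1: "chain_bound d x y (Suc 0) a b = max (d x (a 1)) (d (b 1) y)"
  by (simp add: chain_bound_def)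

lemma chain_bound_Suc:
  "chain_bound d x y (Suc (Suc n)) a b =
     max (chain_bound d x (a (Suc (Suc n))) (Suc n) a b) (d (b (Suc (Suc n))) y)"
proof -
  \<comment> \<open>\<open>Max ?S\<close> is the bound of the shorter chain ending at
    \<open>a (Suc (Suc n))\<close>.\<close>
  let ?S = "{d x (a 1)} \<union> (\<lambda>i. d (b i) (a (i + 1))) ` {1..n} \<union> {d (b (Suc n)) (a (Suc (Suc n)))}"
  have "{d x (a 1)} \<union> (\<lambda>i. d (b i) (a (i + 1))) ` {1..Suc n} \<union> {d (b (Suc (Suc n))) y}
      = insert (d (b (Suc (Suc n))) y) ?S"
    by (auto simp: atLeastAtMostSuc_conv)
  moreover have "Max (insert (d (b (Suc (Suc n))) y) ?S) = max (d (b (Suc (Suc n))) y) (Max ?S)"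
    by (rule Max_insert) auto
  ultimately show ?thesis
    by (simp add: chain_bound_def max.commute)
qed

lemma chain_in_1: "chain_in f (Suc 0) a b \<longleftrightarrow> (a 1, b 1) \<in> f"
  by (simp add: chain_in_def)

lemma chain_in_Suc:
  "chain_in f (Suc (Suc n)) a b \<longleftrightarrow>
     chain_in f (Suc n) a b \<and> (a (Suc (Suc n)), b (Suc (Suc n))) \<in> f"
  by (auto simp: chain_in_def le_Suc_eq)

text \<open>\<open>F\<close> stands for \<open>chain_length\<close> or \<open>chain_bound\<close>.
  The hypothesis \<open>cong\<close> allows sequences to be altered beyond the chain when a link is
  appended.\<close>

lemma chain_cost_iff_chain_in:
  fixes F :: "'a \<Rightarrow> 'a \<Rightarrow> nat \<Rightarrow> (nat \<Rightarrow> 'a) \<Rightarrow> (nat \<Rightarrow> 'a) \<Rightarrow> real"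
  assumes one: "\<And>x y a b. F x y (Suc 0) a b = opr (d x (a 1)) (d (b 1) y)"
    and Suc: "\<And>x y n a b. F x y (Suc (Suc n)) a b =
      opr (F x (a (Suc (Suc n))) (Suc n) a b) (d (b (Suc (Suc n))) y)"
    and cong: "\<And>x y n a b a' b'. (\<And>i. i \<in> {1..Suc n} \<Longrightarrow> a i = a' i \<and> b i = b' i) \<Longrightarrow>
      F x y (Suc n) a b = F x y (Suc n) a' b'"
  shows "chain_cost opr d f x (Suc n) y r \<longleftrightarrow>
    (\<exists>a b. chain_in f (Suc n) a b \<and> r = F x y (Suc n) a b)"
proof (induction n arbitrary: y r)
  case 0
  show ?case
  proof
    assume "chain_cost opr d f x (Suc 0) y r"
    then obtain p q where "(p, q) \<in> f" "r = opr (d x p) (d q y)"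
      by (auto elim!: chain_cost_SucE chain_cost_0E)
    then show "\<exists>a b. chain_in f (Suc 0) a b \<and> r = F x y (Suc 0) a b"
      by (intro exI[of _ "\<lambda>_. p"] exI[of _ "\<lambda>_. q"]) (simp add: chain_in_1 one)
  qed (auto simp: chain_in_1 one intro: chain_cost.intros)
next
  case (Suc n)
  let ?N = "Suc (Suc n)"
  show ?case
  proof
    assume "chain_cost opr d f x ?N y r"
    then obtain p q s where pq: "(p, q) \<in> f" "r = opr s (d q y)"
      and "chain_cost opr d f x (Suc n) p s"
      by (auto elim!: chain_cost_SucE[of _ _ _ _ "Suc n"])
    with Suc obtain a b where ab: "chain_in f (Suc n) a b" "s = F x p (Suc n) a b"
      by blast
    \<comment> \<open>The new link is stored at index \<open>?N\<close>, just past the old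
      chain.\<close>
    let ?a = "a(?N := p)" and ?b = "b(?N := q)"
    have "F x p (Suc n) ?a ?b = F x p (Suc n) a b"
      by (rule cong) auto
    moreover have "chain_in f (Suc n) ?a ?b"
      using ab by (auto simp: chain_in_def)
    ultimately show "\<exists>a b. chain_in f ?N a b \<and> r = F x y ?N a b"
      using pq ab by (intro exI[of _ ?a] exI[of _ ?b]) (simp add: chain_in_Suc assms(2))
  next
    assume "\<exists>a b. chain_in f ?N a b \<and> r = F x y ?N a b"
    then obtain a b where ab: "chain_in f ?N a b" "r = F x y ?N a b" by blast
    then have "chain_cost opr d f x (Suc n) (a ?N) (F x (a ?N) (Suc n) a b)"
      using Suc by (auto simp: chain_in_Suc)
    then show "chain_cost opr d f x ?N y r"
      using ab by (auto simp: chain_in_Suc assms(2) intro: chain_cost.step)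
  qed
qed

lemma chain_cost_iff_chain_length:
  "chain_cost (+) d f x (Suc n) y r \<longleftrightarrow>
     (\<exists>a b. chain_in f (Suc n) a b \<and> r = chain_length d x y (Suc n) a b)"
  by (rule chain_cost_iff_chain_in[OF chain_length_1 chain_length_Suc])
    (auto simp: chain_length_def)

lemma chain_cost_iff_chain_bound:
  "chain_cost max d f x (Suc n) y r \<longleftrightarrow>
     (\<exists>a b. chain_in f (Suc n) a b \<and> r = chain_bound d x y (Suc n) a b)"
proof (rule chain_cost_iff_chain_in[OF chain_bound_1 chain_bound_Suc])
  fix x y :: 'a and n and a b a' b' :: "nat \<Rightarrow> 'a"
  assume eq: "\<And>i. i \<in> {1..Suc n} \<Longrightarrow> a i = a' i \<and> b i = b' i"
  then have "(\<lambda>i. d (b i) (a (i + 1))) ` {1..n} = (\<lambda>i. d (b' i) (a' (i + 1))) ` {1..n}"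
    by (intro image_cong) auto
  with eq show "chain_bound d x y (Suc n) a b = chain_bound d x y (Suc n) a' b'"
    by (simp add: chain_bound_def)
qed

lemma Collect_chain_in:
  "{F n a b | n a b. chain_in f n a b} = {r. \<exists>n a b. chain_in f (Suc n) a b \<and> r = F (Suc n) a b}"
proof -
  have "\<exists>m. n = Suc m" if "chain_in f n a b" for n a b
    using that by (cases n) (auto simp: chain_in_def)
  then show ?thesis by blast
qed

lemma barrier_l_eq: "barrier_l X d = barrier X d (+)"
  unfolding barrier_l_def barrier_def chain_cost_iff_chain_length Collect_chain_in
  by (intro ext) simp

lemma barrier_m_eq: "barrier_m X d = barrier X d max"
  unfolding barrier_m_def barrier_def chain_cost_iff_chain_bound Collect_chain_in
  by (intro ext) simp

lemma A_rel_eq: "A_rel X d = barrier_rel X d (+)"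
  by (intro ext) (simp add: A_rel_def barrier_rel_def barrier_l_eq)

lemma C_rel_eq: "C_rel X d = barrier_rel X d max"
  by (intro ext) (simp add: C_rel_def barrier_rel_def barrier_m_eq)

theorem proposition3p1:
  fixes X :: "'a set" and d :: "'a \<Rightarrow> 'a \<Rightarrow> real" and f g :: "('a \<times> 'a) set"
  assumes "X \<noteq> {}"
    and "bounded_pseudo_metric_on X d"
    and "f \<subseteq> X \<times> X" and "g \<subseteq> X \<times> X"
  shows "(\<forall>x\<in>X. \<forall>y\<in>X. barrier_m X d (C_rel X d f) x y = barrier_m X d f x y)
    \<and> (\<forall>x\<in>X. \<forall>y\<in>X. barrier_l X d (A_rel X d f) x y = barrier_l X d f x y)
    \<and> C_rel X d (C_rel X d f) = C_rel X d f
    \<and> A_rel X d (A_rel X d f) = A_rel X d f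
    \<and> C_rel X d (C_rel X d f \<inter> C_rel X d g) = C_rel X d f \<inter> C_rel X d g
    \<and> A_rel X d (A_rel X d f \<inter> A_rel X d g) = A_rel X d f \<inter> A_rel X d g"
proof -
  interpret bounded_pseudo_metric_on X d by fact
  interpret plus: barrier_operation X d "(+)"
    by unfold_locales auto
  interpret max: barrier_operation X d max
    by unfold_locales auto
  show ?thesis
    unfolding barrier_l_eq barrier_m_eq A_rel_eq C_rel_eq
    using assms(3,4) plus.bar_rel max.bar_rel plus.rel_rel max.rel_rel
      plus.rel_inter_rel max.rel_inter_rel by simp
qed

end
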